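(* Let $t$ and $\Delta$ be non-negative integers, let $H$ be a $t$-tree, let $I$ be a graph of maximum degree $\Delta$, and let $G$ be a subgraph of the strong product $H\boxtimes I$. Then $G$ has an odd colouring using at most $(\Delta^2+\Delta)(t+1)+2t+1$ colours.
   Context: All graphs are finite and simple. A $t$-tree is a graph that is either a clique on $t+1$ vertices, or a graph $H$ containing a vertex $v$ of degree $t$ whose neighbours form a clique and such that $H-\{v\}$ is a $t$-tree. For graphs $A$ and $B$, the strong product $A\boxtimes B$ has vertex set $V(A)\times V(B)$, and $(x_1,y_1)(x_2,y_2)$ is an edge iff (i) $x_1x_2\in E(A)$ and $y_1=y_2$, or (ii) $x_1=x_2$ and $y_1y_2\in E(B)$, or (iii) $x_1x_2\in E(A)$ and $y_1y_2\in E(B)$. A vertex colouring $\varphi:V(G)\to\mathbb{N}$ (not necessarily proper) is odd if for every vertex $v$ with $|N_G(v)|>0$ there is a colour $\alpha$ such that $|\{w\in N_G(v):\varphi(w)=\alpha\}|$ is odd. A colouring uses $c$ colours if $|\{\varphi(v):v\in V(G)\}|=c$. *)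

theory Defs
  imports "Graph_Theory.Graph_Theory"
begin

text \<open>
  A finite simple graph is a \<^typ>\<open>'a pair_pre_digraph\<close> satisfying \<^const>\<open>pair_graph\<close>:
  an edge \<open>uv\<close> is represented by the two arcs \<open>(u, v)\<close> and \<open>(v, u)\<close>.
\<close>

definition nbhd :: "'a pair_pre_digraph \<Rightarrow> 'a \<Rightarrow> 'a set" where
  "nbhd G v = {w. (v, w) \<in> parcs G}"

definition degree :: "'a pair_pre_digraph \<Rightarrow> 'a \<Rightarrow> nat" where
  "degree G v = card (nbhd G v)"

text \<open>The inserted \<open>0\<close> only matters for the graph without vertices, whose maximum degree is 0.\<close>

definition max_degree :: "'a pair_pre_digraph \<Rightarrow> nat" where
  "max_degree G = Max (insert 0 (degree G ` pverts G))"

definition delete_vertex :: "'a pair_pre_digraph \<Rightarrow> 'a \<Rightarrow> 'a pair_pre_digraph" where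
  "delete_vertex G v =
     \<lparr> pverts = pverts G - {v}, parcs = {(x, y) \<in> parcs G. x \<noteq> v \<and> y \<noteq> v} \<rparr>"

definition is_clique :: "'a pair_pre_digraph \<Rightarrow> 'a set \<Rightarrow> bool" where
  "is_clique G S \<longleftrightarrow> S \<subseteq> pverts G \<and> (\<forall>x\<in>S. \<forall>y\<in>S. x \<noteq> y \<longrightarrow> (x, y) \<in> parcs G)"

inductive t_tree :: "nat \<Rightarrow> 'a pair_pre_digraph \<Rightarrow> bool" for t :: nat where
  clique: "complete_digraph (t + 1) (with_proj K) \<Longrightarrow> t_tree t K"
| extend: "\<lbrakk> pair_graph H; v \<in> pverts H; degree H v = t; is_clique H (nbhd H v);
             t_tree t (delete_vertex H v) \<rbrakk> \<Longrightarrow> t_tree t H"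

definition strong_product ::
    "'a pair_pre_digraph \<Rightarrow> 'b pair_pre_digraph \<Rightarrow> ('a \<times> 'b) pair_pre_digraph"
    (infixl \<open>\<boxtimes>\<close> 70) where
  "A \<boxtimes> B =
     \<lparr> pverts = pverts A \<times> pverts B,
       parcs = {((x1, y1), (x2, y2)) | x1 y1 x2 y2.
         (x1, y1) \<in> pverts A \<times> pverts B \<and> (x2, y2) \<in> pverts A \<times> pverts B \<and>
         ((x1, x2) \<in> parcs A \<and> y1 = y2 \<or>
          x1 = x2 \<and> (y1, y2) \<in> parcs B \<or>
          (x1, x2) \<in> parcs A \<and> (y1, y2) \<in> parcs B)} \<rparr>"

text \<open>Odd colourings are not required to be proper.\<close>

definition odd_colouring :: "'a pair_pre_digraph \<Rightarrow> ('a \<Rightarrow> nat) \<Rightarrow> bool" where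
  "odd_colouring G \<phi> \<longleftrightarrow>
     (\<forall>v\<in>pverts G. card (nbhd G v) > 0 \<longrightarrow>
        (\<exists>\<alpha>. odd (card {w \<in> nbhd G v. \<phi> w = \<alpha>})))"

definition num_colours :: "'a pair_pre_digraph \<Rightarrow> ('a \<Rightarrow> nat) \<Rightarrow> nat" where
  "num_colours G \<phi> = card (\<phi> ` pverts G)"

lemma t_tree_pair_graph: "t_tree t H \<Longrightarrow> pair_graph H"
  by (induction rule: t_tree.induct) (auto simp: complete_digraph_def intro: pair_graphI_graph)

lemma pair_graph_strong_product:
  assumes "pair_graph A" "pair_graph B"
  shows "pair_graph (A \<boxtimes> B)"
proof -
  interpret A: pair_graph A by fact
  interpret B: pair_graph B by fact
  have fin: "finite (pverts (A \<boxtimes> B))"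
    by (simp add: strong_product_def)
  have sub: "parcs (A \<boxtimes> B) \<subseteq> pverts (A \<boxtimes> B) \<times> pverts (A \<boxtimes> B)"
    by (auto simp: strong_product_def)
  have "finite (parcs (A \<boxtimes> B))"
    using finite_subset[OF sub] fin by simp
  moreover have "sym (parcs (A \<boxtimes> B))"
    by (rule symI) (auto simp: strong_product_def intro: A.arcs_symmetric B.arcs_symmetric)
  ultimately show ?thesis
    using fin sub
    by unfold_locales
      (auto simp: symmetric_def strong_product_def dest: A.no_loops' B.no_loops')
qed

end

theory Submission
  imports Defs
begin

text \<open>
  Build \<open>H\<close> by successively adding vertices, each joined to a clique of at most \<open>t\<close> earlier ones,
  and colour \<open>V(H) \<times> V(I)\<close> greedily in lexicographic order. When \<open>(x, y)\<close> is coloured, avoid the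
  colours of all earlier \<open>(x', y')\<close> with \<open>x'\<close> equal or adjacent to \<open>x\<close> and \<open>y'\<close> at distance at most
  two from \<open>y\<close>; there are at most \<open>t(\<Delta>\<^sup>2 + 1) + \<Delta>\<^sup>2\<close> of these. Avoid also, for each of the at most
  \<open>t(\<Delta> + 1) + \<Delta>\<close> earlier neighbours of \<open>(x, y)\<close>, one colour that so far occurs an odd number of times
  around it. The first condition makes the earlier neighbours of \<open>(x, y)\<close> distinctly coloured, so
  that \<open>(x, y)\<close> sees some colour exactly once; the second maintains this oddness afterwards.
\<close>

section \<open>Greedy odd colouring along a vertex order\<close>

text \<open>This is the greedy argument freed from the product structure: \<open>f\<close> gives the
  colouring order, \<open>C\<close> the pairs that must differ. The sum in \<open>few\<close> counts
  the colours forbidden to \<open>v\<close>: one per earlier conflicting vertex, one per earlier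
  neighbour.\<close>

lemma greedy_odd_colouring:
  fixes f :: "'v \<Rightarrow> nat" and N :: "'v \<Rightarrow> 'v set" and C :: "'v \<Rightarrow> 'v \<Rightarrow> bool"
  assumes "finite V" and inj: "inj_on f V"
    and symN: "\<And>u v. u \<in> N v \<Longrightarrow> v \<in> N u" and irrN: "\<And>v. v \<notin> N v"
    and symC: "\<And>u v. C u v \<Longrightarrow> C v u"
    and conflict: "\<And>v u w. \<lbrakk>v \<in> V; u \<in> V; w \<in> V; u \<in> N v; w \<in> N v; f u < f v; f w < f v\<rbrakk>
           \<Longrightarrow> C u w"
    and few: "\<And>v. v \<in> V \<Longrightarrow>
           card {u \<in> V. f u < f v \<and> C u v} + card {u \<in> V. f u < f v \<and> u \<in> N v} < k"
  shows "\<exists>\<phi> :: 'v \<Rightarrow> nat. \<phi> ` V \<subseteq> {..<k} \<and>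
           (\<forall>v\<in>V. N v \<inter> V \<noteq> {} \<longrightarrow> (\<exists>\<alpha>. odd (card {w \<in> N v \<inter> V. \<phi> w = \<alpha>})))"
proof -
  define odd_at where "odd_at \<phi> S v \<alpha> \<longleftrightarrow> odd (card {w \<in> N v \<inter> S. \<phi> w = \<alpha>})"
    for \<phi> :: "'v \<Rightarrow> nat" and S v \<alpha>
  \<comment> \<open>The invariant for an initial segment \<open>S\<close> of the order, with
    neighbours counted inside \<open>S\<close> only. The conflict clause is carried along because
    the next vertex relies on it to see a colour exactly once.\<close>
  define good where "good \<phi> S \<longleftrightarrow> \<phi> ` S \<subseteq> {..<k} \<and>
      (\<forall>u\<in>S. \<forall>w\<in>S. u \<noteq> w \<longrightarrow> C u w \<longrightarrow> \<phi> u \<noteq> \<phi> w) \<and>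
      (\<forall>v\<in>S. N v \<inter> S \<noteq> {} \<longrightarrow> (\<exists>\<alpha>. odd_at \<phi> S v \<alpha>))" for \<phi> :: "'v \<Rightarrow> nat" and S
  \<comment> \<open>Ranking induction inserts vertices by nondecreasing \<open>f\<close>. It allows
    \<open>x\<close> to lie in \<open>S\<close> already, hence the case split; otherwise injectivity
    makes \<open>x\<close> strictly last.\<close>
  have "S \<subseteq> V \<longrightarrow> (\<exists>\<phi>. good \<phi> S)" if "finite S" for S
    using that
  proof (induction S rule: finite_ranking_induct[where f = f])
    case empty
    show ?case by (auto simp: good_def)
  next
    case (insert x S)
    show ?case
    proof (cases "x \<in> S")
      case True
      then show ?thesis using insert by (simp add: insert_absorb)
    next
      case False
      show ?thesis
      proof
        assume sub: "insert x S \<subseteq> V"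
        then obtain \<phi> where "good \<phi> S" using insert by auto
        then have range: "\<phi> ` S \<subseteq> {..<k}"
          and proper: "\<And>u w. u \<in> S \<Longrightarrow> w \<in> S \<Longrightarrow> u \<noteq> w \<Longrightarrow> C u w \<Longrightarrow> \<phi> u \<noteq> \<phi> w"
          and odd: "\<And>v. v \<in> S \<Longrightarrow> N v \<inter> S \<noteq> {} \<Longrightarrow> \<exists>\<alpha>. odd_at \<phi> S v \<alpha>"
          by (auto simp: good_def)
        have less: "f u < f x" if "u \<in> S" for u
        proof -
          have "u \<noteq> x" using that False by auto
          then have "f u \<noteq> f x" using inj that sub by (auto dest: inj_onD)
          then show ?thesis using insert(2)[OF that] by simp
        qed
        \<comment> \<open>One odd colour to protect per coloured vertex. Without neighbours in
          \<open>S\<close> the value is unspecified; avoiding it is harmless and stays within the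
          count.\<close>
        define a where "a v = (SOME \<alpha>. odd_at \<phi> S v \<alpha>)" for v
        have a: "odd_at \<phi> S v (a v)" if "v \<in> S" "N v \<inter> S \<noteq> {}" for v
          unfolding a_def using odd[OF that] by (rule someI_ex)
        define F where "F = \<phi> ` {u \<in> S. C u x} \<union> a ` {u \<in> S. u \<in> N x}"
        have "card F \<le> card {u \<in> S. C u x} + card {u \<in> S. u \<in> N x}"
          unfolding F_def using \<open>finite S\<close>
          by (intro order.trans[OF card_Un_le] add_mono card_image_le) auto
        also have "\<dots> \<le> card {u \<in> V. f u < f x \<and> C u x} + card {u \<in> V. f u < f x \<and> u \<in> N x}"
          using sub less \<open>finite V\<close> by (intro add_mono card_mono) auto
        also have "\<dots> < k" using few sub by auto
        finally have "card F < card {..<k}" by simp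
        moreover have "finite F" unfolding F_def using \<open>finite S\<close> by auto
        ultimately obtain c where c: "c < k" "c \<notin> F"
          using card_mono[of F "{..<k}"] by (metis lessThan_iff linorder_not_less subsetI)
        define \<psi> where "\<psi> = \<phi>(x := c)"
        have \<psi>: "\<psi> x = c" "\<And>u. u \<in> S \<Longrightarrow> \<psi> u = \<phi> u" using False by (auto simp: \<psi>_def)
        have range': "\<psi> ` insert x S \<subseteq> {..<k}" using range c \<psi> by auto
        have proper': "\<psi> u \<noteq> \<psi> w"
          if "u \<in> insert x S" "w \<in> insert x S" "u \<noteq> w" "C u w" for u w
        proof -
          have "\<phi> u \<noteq> c" if "u \<in> S" "C u x" for u using that c(2) by (auto simp: F_def)
          then show ?thesis using that proper \<psi> symC by (metis insertE)
        qed
        have odd': "\<exists>\<alpha>. odd_at \<psi> (insert x S) v \<alpha>"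
          if v: "v \<in> insert x S" "N v \<inter> insert x S \<noteq> {}" for v
        proof (cases "v = x")
          case True
          \<comment> \<open>Any earlier neighbour \<open>w\<close> of \<open>x\<close> will do: by
            \<open>conflict\<close> no other earlier neighbour shares its colour.\<close>
          then obtain w where w: "w \<in> N x" "w \<in> S" using v irrN by auto
          have "\<phi> u \<noteq> \<phi> w" if "u \<in> N x" "u \<in> S" "u \<noteq> w" for u
            using conflict[of x u w] proper[of u w] that w sub less by auto
          then have "{u \<in> N x \<inter> S. \<phi> u = \<phi> w} = {w}" using w by blast
          moreover have "{u \<in> N x \<inter> insert x S. \<psi> u = \<phi> w} = {u \<in> N x \<inter> S. \<phi> u = \<phi> w}"
            using irrN[of x] \<psi>(2) by auto
          ultimately have "{u \<in> N x \<inter> insert x S. \<psi> u = \<phi> w} = {w}" by simp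
          then have "odd_at \<psi> (insert x S) x (\<phi> w)" by (simp add: odd_at_def)
          then show ?thesis using True by auto
        next
          case False
          then have vS: "v \<in> S" using v by auto
          show ?thesis
          \<comment> \<open>If \<open>x\<close> is the first neighbour of \<open>v\<close> to be
            coloured, \<open>c\<close> occurs once around \<open>v\<close>. Otherwise the count of
            \<open>a v\<close> is unchanged, as \<open>c\<close> differs from it whenever
            \<open>x\<close> is adjacent to \<open>v\<close>.\<close>
          proof (cases "N v \<inter> S = {}")
            case True
            then have "{w \<in> N v \<inter> insert x S. \<psi> w = c} = {x}" using v \<psi> by auto
            then have "odd_at \<psi> (insert x S) v c" by (simp add: odd_at_def)
            then show ?thesis ..
          next
            case ne: False
            have "c \<noteq> a v" if "x \<in> N v" using that symN[OF that] vS c(2) by (auto simp: F_def)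
            then have "{w \<in> N v \<inter> insert x S. \<psi> w = a v} = {w \<in> N v \<inter> S. \<phi> w = a v}"
              using \<psi> by auto
            then have "odd_at \<psi> (insert x S) v (a v)" using a[OF vS ne] by (simp add: odd_at_def)
            then show ?thesis ..
          qed
        qed
        show "\<exists>\<phi>. good \<phi> (insert x S)"
          unfolding good_def using range' proper' odd' by blast
      qed
    qed
  qed
  from this[OF \<open>finite V\<close>] show ?thesis by (auto simp: good_def odd_at_def)
qed

section \<open>Cliques and balls of radius two\<close>

lemma is_cliqueD: "\<lbrakk>is_clique G S; x \<in> S; y \<in> S; x \<noteq> y\<rbrakk> \<Longrightarrow> (x, y) \<in> parcs G"
  by (auto simp: is_clique_def)

text \<open>The closed ball of radius two around \<open>y\<close>.\<close>

definition ball2 :: "'a pair_pre_digraph \<Rightarrow> 'a \<Rightarrow> 'a set" where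
  "ball2 I y = insert y (\<Union>z\<in>nbhd I y. insert z (nbhd I z))"

context pair_graph
begin

lemma nbhd_subset_pverts: "nbhd G v \<subseteq> pverts G"
  unfolding nbhd_def using in_arcsD2 by blast

lemma finite_nbhd: "finite (nbhd G v)"
  using finite_subset[OF nbhd_subset_pverts] finite_verts by simp

lemma nbhd_sym: "u \<in> nbhd G v \<Longrightarrow> v \<in> nbhd G u"
  unfolding nbhd_def using arcs_symmetric by blast

lemma not_in_nbhd_self: "v \<notin> nbhd G v"
  unfolding nbhd_def using no_loops' by blast

lemma card_nbhd_le_max_degree: "card (nbhd G v) \<le> max_degree G"
proof (cases "v \<in> pverts G")
  case True
  then have "degree G v \<le> max_degree G"
    unfolding max_degree_def using finite_verts by (intro Max_ge) auto
  then show ?thesis by (simp add: degree_def)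
next
  case False
  then have "nbhd G v = {}" unfolding nbhd_def using in_arcsD1 by blast
  then show ?thesis by simp
qed

lemma finite_ball2: "finite (ball2 G y)"
  by (auto simp: ball2_def finite_nbhd)

lemma ball2_sym: "y \<in> ball2 G z \<Longrightarrow> z \<in> ball2 G y"
  unfolding ball2_def using nbhd_sym by blast

text \<open>Each neighbour \<open>z\<close> of \<open>y\<close> contributes itself and its
  neighbours other than \<open>y\<close>. Trading \<open>y\<close> for \<open>z\<close> leaves as
  many vertices as the degree of \<open>z\<close>, and there are at most \<open>max_degree G\<close>
  choices of \<open>z\<close>.\<close>

lemma card_ball2_minus_centre: "card (ball2 G y - {y}) \<le> (max_degree G)\<^sup>2"
proof -
  have "card (insert z (nbhd G z - {y})) \<le> max_degree G" if "z \<in> nbhd G y" for z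
  proof -
    have "y \<in> nbhd G z" using that by (rule nbhd_sym)
    then have "card (insert z (nbhd G z - {y})) = card (nbhd G z)"
      using finite_nbhd not_in_nbhd_self
      by (metis Diff_iff card_Suc_Diff1 card_insert_disjoint finite_Diff)
    then show ?thesis using card_nbhd_le_max_degree by simp
  qed
  then have "card (\<Union>z\<in>nbhd G y. insert z (nbhd G z - {y})) \<le> (\<Sum>z\<in>nbhd G y. max_degree G)"
    by (intro order.trans[OF card_UN_le] sum_mono finite_nbhd)
  also have "\<dots> \<le> (max_degree G)\<^sup>2"
    using card_nbhd_le_max_degree by (simp add: power2_eq_square)
  finally have "card (\<Union>z\<in>nbhd G y. insert z (nbhd G z - {y})) \<le> (max_degree G)\<^sup>2" .
  moreover have "ball2 G y - {y} \<subseteq> (\<Union>z\<in>nbhd G y. insert z (nbhd G z - {y}))"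
    by (auto simp: ball2_def)
  ultimately show ?thesis
    by (meson card_mono finite_UN_I finite_nbhd finite_Diff finite_insert order_trans)
qed

lemma card_ball2: "card (ball2 G y) \<le> (max_degree G)\<^sup>2 + 1"
proof -
  have "y \<in> ball2 G y" by (simp add: ball2_def)
  then have "card (ball2 G y) = Suc (card (ball2 G y - {y}))"
    using finite_ball2 by (metis card_Suc_Diff1)
  then show ?thesis using card_ball2_minus_centre[of y] by simp
qed

end

section \<open>Elimination orders of \<open>t\<close>-trees\<close>

text \<open>The recursive construction read as an order: an initial clique may be ranked
  arbitrarily, and each added vertex is ranked last, so its earlier neighbours are the clique of
  size \<open>t\<close> it was attached to.\<close>

lemma t_tree_elimination_order:
  assumes "t_tree t H"
  shows "\<exists>r :: 'a \<Rightarrow> nat. inj_on r (pverts H) \<and>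
           (\<forall>v\<in>pverts H. card {u \<in> nbhd H v. r u < r v} \<le> t \<and>
                         is_clique H {u \<in> nbhd H v. r u < r v})"
  using assms
proof (induction rule: t_tree.induct)
  case (clique K)
  interpret K: pair_graph K
    using t_tree.clique[OF clique] by (rule t_tree_pair_graph)
  have arcs: "(u, w) \<in> parcs K \<longleftrightarrow> u \<in> pverts K \<and> w \<in> pverts K \<and> u \<noteq> w" for u w
    using clique by (auto simp: complete_digraph_def arcs_ends_def arc_to_ends_def)
  have card: "card (pverts K) = t + 1" using clique by (simp add: complete_digraph_def)
  obtain r :: "'a \<Rightarrow> nat" where r: "inj_on r (pverts K)"
    using K.finite_verts finite_imp_inj_to_nat_seg by (metis with_proj_simps(1))
  have "card {u \<in> nbhd K v. r u < r v} \<le> t" if "v \<in> pverts K" for v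
  proof -
    have "card {u \<in> nbhd K v. r u < r v} \<le> card (pverts K - {v})"
      using K.finite_verts by (intro card_mono) (auto simp: nbhd_def arcs)
    then show ?thesis using card that by simp
  qed
  then show ?case using r by (auto simp: is_clique_def nbhd_def arcs)
next
  case (extend H v)
  interpret H: pair_graph H by fact
  obtain r :: "'a \<Rightarrow> nat" where r: "inj_on r (pverts (delete_vertex H v))"
    and earlier: "\<And>w. w \<in> pverts (delete_vertex H v) \<Longrightarrow>
        card {u \<in> nbhd (delete_vertex H v) w. r u < r w} \<le> t \<and>
        is_clique (delete_vertex H v) {u \<in> nbhd (delete_vertex H v) w. r u < r w}"
    using extend.IH by blast
  have fin: "finite (pverts H)" using H.finite_verts by simp
  define m where "m = Suc (Max (r ` pverts H))"
  have m: "r u < m" if "u \<in> pverts H" for u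
    using that fin by (auto simp: m_def less_Suc_eq_le)
  define s where "s = r(v := m)"
  have inj: "inj_on s (pverts H)"
  proof (rule inj_onI)
    fix a b assume "a \<in> pverts H" "b \<in> pverts H" "s a = s b"
    then show "a = b" using r m[of a] m[of b]
      by (auto simp: s_def delete_vertex_def dest: inj_onD split: if_splits)
  qed
  have "card {u \<in> nbhd H w. s u < s w} \<le> t \<and> is_clique H {u \<in> nbhd H w. s u < s w}"
    if w: "w \<in> pverts H" for w
  proof (cases "w = v")
    case True
    have "card {u \<in> nbhd H v. s u < s v} \<le> degree H v"
      unfolding degree_def using H.finite_nbhd by (intro card_mono) auto
    then show ?thesis using True extend.hyps by (auto simp: is_clique_def)
  next
    case False
    \<comment> \<open>Since \<open>v\<close> ranks above \<open>w\<close>, it is never an earlier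
      neighbour of \<open>w\<close>, so deleting it changes nothing here.\<close>
    then have "{u \<in> nbhd H w. s u < s w} = {u \<in> nbhd (delete_vertex H v) w. r u < r w}"
      using m[OF w] by (auto simp: nbhd_def delete_vertex_def s_def)
    moreover have "w \<in> pverts (delete_vertex H v)" using False w by (simp add: delete_vertex_def)
    moreover have "is_clique H K" if "is_clique (delete_vertex H v) K" for K
      using that by (auto simp: is_clique_def delete_vertex_def)
    ultimately show ?thesis using earlier by presburger
  qed
  with inj show ?case by blast
qed

section \<open>Lexicographic colouring of the strong product\<close>

theorem theorem5:
  fixes t \<Delta> :: nat
    and H :: "'a pair_pre_digraph"
    and I :: "'b pair_pre_digraph"
    and G :: "('a \<times> 'b) pair_pre_digraph"
  assumes "t_tree t H"
    and "pair_graph I"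
    and "max_degree I = \<Delta>"
    and "pair_graph G"
    and "subgraph (with_proj G) (with_proj (H \<boxtimes> I))"
  shows "\<exists>\<phi>. odd_colouring G \<phi> \<and>
           num_colours G \<phi> \<le> (\<Delta>^2 + \<Delta>) * (t + 1) + 2 * t + 1"
proof -
  interpret H: pair_graph H using \<open>t_tree t H\<close> by (rule t_tree_pair_graph)
  interpret I: pair_graph I by fact
  interpret G: pair_graph G by fact
  let ?k = "(\<Delta>^2 + \<Delta>) * (t + 1) + 2 * t + 1"
  obtain r :: "'a \<Rightarrow> nat" where r: "inj_on r (pverts H)"
    and earlier: "\<And>x. x \<in> pverts H \<Longrightarrow> card {u \<in> nbhd H x. r u < r x} \<le> t"
      "\<And>x. x \<in> pverts H \<Longrightarrow> is_clique H {u \<in> nbhd H x. r u < r x}"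
    using t_tree_elimination_order[OF \<open>t_tree t H\<close>] by blast
  have "finite (pverts I)" using I.finite_verts by simp
  then obtain s :: "'b \<Rightarrow> nat" and n where s: "inj_on s (pverts I)" "s ` pverts I = {i. i < n}"
    using finite_imp_inj_to_nat_seg by (metis)
  \<comment> \<open>Because \<open>s\<close> takes values below \<open>n\<close>, it acts as the
    last digit in base \<open>n\<close>, and \<open>f\<close> encodes the lexicographic
    order.\<close>
  define f where "f = (\<lambda>(x, y). r x * n + s y)"
  \<comment> \<open>Two neighbours of \<open>(x, y)\<close> have second coordinates within distance
    one of \<open>y\<close>, hence within two of each other. In the first coordinate adjacency
    suffices, since earlier neighbours in \<open>H\<close> form a clique.\<close>
  define C where "C = (\<lambda>(x, y) (x', y'). (x = x' \<or> x \<in> nbhd H x') \<and> y \<in> ball2 I y')"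
  have V: "pverts G \<subseteq> pverts H \<times> pverts I"
    using assms(5) by (auto simp: subgraph_def strong_product_def)
  have N: "(x = x' \<or> x \<in> nbhd H x') \<and> (y = y' \<or> y \<in> nbhd I y') \<and> (x = x' \<longrightarrow> y \<in> nbhd I y')"
    if "(x, y) \<in> nbhd G (x', y')" for x y x' y'
  proof -
    have "((x', y'), (x, y)) \<in> parcs (H \<boxtimes> I)"
      using that assms(5) by (auto simp: subgraph_def nbhd_def)
    then show ?thesis
      using H.no_loops' by (auto simp: strong_product_def nbhd_def)
  qed
  have f_mono: "f (x, y) < f (x', y')" if "r x < r x'" "y \<in> pverts I" for x y x' y'
  proof -
    have "s y < n" using s that by auto
    then have "f (x, y) < (r x + 1) * n" by (simp add: f_def)
    also have "\<dots> \<le> r x' * n" using that by (intro mult_right_mono) auto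
    finally show ?thesis by (simp add: f_def)
  qed
  \<comment> \<open>The clause \<open>y \<noteq> y'\<close> later removes the centre from the ball
    over \<open>x\<close> itself.\<close>
  have f_less: "r x < r x' \<or> x = x' \<and> y \<noteq> y'"
    if "f (x, y) < f (x', y')" "(x, y) \<in> pverts G" "(x', y') \<in> pverts G" for x y x' y'
  proof (cases "r x = r x'")
    case True
    then have "x = x'" using r that V by (auto dest: inj_onD)
    then show ?thesis using that by auto
  next
    case False
    then show ?thesis using f_mono[of x' x y' y] that V by force
  qed
  have inj: "inj_on f (pverts G)"
  proof (rule inj_onI, clarify)
    fix x y x' y' assume xy: "(x, y) \<in> pverts G" "(x', y') \<in> pverts G" "f (x, y) = f (x', y')"
    then have mem: "x \<in> pverts H" "x' \<in> pverts H" "y \<in> pverts I" "y' \<in> pverts I" using V by auto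
    then have "r x = r x'"
      using f_mono[of x x' y y'] f_mono[of x' x y' y] xy(3) by (metis less_irrefl linorder_neqE_nat)
    moreover from this have "s y = s y'" using xy(3) by (simp add: f_def)
    ultimately show "x = x' \<and> y = y'" using r s mem by (auto dest: inj_onD)
  qed
  have conflict: "C u w"
    if "v \<in> pverts G" "u \<in> pverts G" "w \<in> pverts G" "u \<in> nbhd G v" "w \<in> nbhd G v"
      "f u < f v" "f w < f v" for v u w
  proof -
    obtain x y where v: "v = (x, y)" by fastforce
    obtain x1 y1 where u: "u = (x1, y1)" by fastforce
    obtain x2 y2 where w: "w = (x2, y2)" by fastforce
    have x: "x \<in> pverts H" using V that v by auto
    have back1: "x1 = x \<or> x1 \<in> {z \<in> nbhd H x. r z < r x}"
      using N[of x1 y1 x y] f_less[of x1 y1 x y] that u v by auto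
    have back2: "x2 = x \<or> x2 \<in> {z \<in> nbhd H x. r z < r x}"
      using N[of x2 y2 x y] f_less[of x2 y2 x y] that w v by auto
    have "x1 = x2 \<or> x1 \<in> nbhd H x2"
    proof (cases "x1 = x \<or> x2 = x")
      case True
      then show ?thesis using back1 back2 H.nbhd_sym by auto
    next
      case False
      then have "x1 \<in> {z \<in> nbhd H x. r z < r x}" "x2 \<in> {z \<in> nbhd H x. r z < r x}"
        using back1 back2 by simp_all
      then have "(x2, x1) \<in> parcs H" if "x2 \<noteq> x1"
        using is_cliqueD[OF earlier(2)[OF x] _ _ that] by simp
      then show ?thesis by (auto simp: nbhd_def)
    qed
    moreover have "y1 = y \<or> y1 \<in> nbhd I y" "y2 = y \<or> y \<in> nbhd I y2"
      using N[of x1 y1 x y] N[of x2 y2 x y] that u v w I.nbhd_sym by blast+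
    then have "y1 \<in> ball2 I y2" by (auto simp: ball2_def)
    ultimately show ?thesis by (simp add: C_def u w)
  qed
  have few: "card {u \<in> pverts G. f u < f v \<and> C u v} +
      card {u \<in> pverts G. f u < f v \<and> u \<in> nbhd G v} < ?k" if "v \<in> pverts G" for v
  proof -
    obtain x y where v: "v = (x, y)" by fastforce
    have x: "x \<in> pverts H" using V that v by auto
    define B where "B = {z \<in> nbhd H x. r z < r x}"
    have B: "finite B" "card B \<le> t" using earlier(1)[OF x] H.finite_nbhd by (auto simp: B_def)
    \<comment> \<open>Earlier conflicts lie over an earlier neighbour of \<open>x\<close>, with a
      full ball, or over \<open>x\<close>, with the centre removed.\<close>
    have "u \<in> B \<times> ball2 I y \<union> {x} \<times> (ball2 I y - {y})"
      if u: "u \<in> pverts G" "f u < f v" "C u v" for u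
    proof -
      obtain x' y' where "u = (x', y')" by fastforce
      then show ?thesis
        using f_less[of x' y' x y] u \<open>v \<in> pverts G\<close> by (auto simp: C_def B_def v)
    qed
    then have "card {u \<in> pverts G. f u < f v \<and> C u v}
        \<le> card (B \<times> ball2 I y \<union> {x} \<times> (ball2 I y - {y}))"
      using B I.finite_ball2 by (intro card_mono) auto
    also have "\<dots> \<le> card B * card (ball2 I y) + card (ball2 I y - {y})"
      by (rule order.trans[OF card_Un_le]) (simp add: card_cartesian_product)
    also have "\<dots> \<le> t * (\<Delta>^2 + 1) + \<Delta>^2"
      using B I.card_ball2 I.card_ball2_minus_centre \<open>max_degree I = \<Delta>\<close>
      by (intro add_mono mult_mono) auto
    finally have C: "card {u \<in> pverts G. f u < f v \<and> C u v} \<le> t * (\<Delta>^2 + 1) + \<Delta>^2" .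
    \<comment> \<open>Likewise with closed neighbourhoods of \<open>y\<close> over \<open>B\<close>
      and the open one over \<open>x\<close>.\<close>
    have "u \<in> B \<times> insert y (nbhd I y) \<union> {x} \<times> nbhd I y"
      if u: "u \<in> pverts G" "f u < f v" "u \<in> nbhd G v" for u
    proof -
      obtain x' y' where "u = (x', y')" by fastforce
      then show ?thesis
        using N[of x' y' x y] f_less[of x' y' x y] u \<open>v \<in> pverts G\<close> by (auto simp: B_def v)
    qed
    then have "card {u \<in> pverts G. f u < f v \<and> u \<in> nbhd G v}
        \<le> card (B \<times> insert y (nbhd I y) \<union> {x} \<times> nbhd I y)"
      using B I.finite_nbhd by (intro card_mono) auto
    also have "\<dots> \<le> card B * card (insert y (nbhd I y)) + card (nbhd I y)"
      by (rule order.trans[OF card_Un_le]) (simp add: card_cartesian_product)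
    also have "\<dots> \<le> t * (\<Delta> + 1) + \<Delta>"
      using B I.card_nbhd_le_max_degree[of y] \<open>max_degree I = \<Delta>\<close> I.finite_nbhd I.not_in_nbhd_self
      by (intro add_mono mult_mono) auto
    \<comment> \<open>The two bounds add up to exactly \<open>?k - 1\<close>, leaving one free
      colour.\<close>
    finally show ?thesis using C by (simp add: algebra_simps)
  qed
  have "C u v \<Longrightarrow> C v u" for u v
    using H.nbhd_sym I.ball2_sym by (auto simp: C_def)
  then obtain \<phi> :: "'a \<times> 'b \<Rightarrow> nat" where \<phi>: "\<phi> ` pverts G \<subseteq> {..<?k}"
    "\<forall>v\<in>pverts G. nbhd G v \<inter> pverts G \<noteq> {} \<longrightarrow>
       (\<exists>\<alpha>. odd (card {w \<in> nbhd G v \<inter> pverts G. \<phi> w = \<alpha>}))"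
    using greedy_odd_colouring[of "pverts G" f "nbhd G" C ?k]
      G.finite_verts inj G.nbhd_sym G.not_in_nbhd_self conflict few by auto
  have "nbhd G v \<inter> pverts G = nbhd G v" for v by (rule Int_absorb2[OF G.nbhd_subset_pverts])
  then have "odd_colouring G \<phi>" using \<phi>(2) by (auto simp: odd_colouring_def)
  moreover have "num_colours G \<phi> \<le> ?k"
    unfolding num_colours_def using card_mono[OF _ \<phi>(1)] by simp
  ultimately show ?thesis by blast
qed

end
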